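(* Let $T=\mathrm{diag}(t_1,t_2,t_3)$ be a real diagonal $3\times 3$ matrix with $t_1t_2t_3\neq 0$, and let $\boldsymbol v\in\mathbb{R}^3$ be any nonzero vector. Then \[ \int_{\{\boldsymbol n\in S^2:\ \boldsymbol n\cdot\boldsymbol v\geq 0\}} \frac{\boldsymbol n}{(\boldsymbol n^\intercal T^{-2}\boldsymbol n)^{2}}\,\mathrm{d}^2\boldsymbol n \;=\; \frac{\pi\,|\det T|\, T^2\boldsymbol v}{|T\boldsymbol v|}, \] where the integral is taken componentwise.
   Context: $S^2$ denotes the unit sphere in $\mathbb{R}^3$ and $\mathrm{d}^2\boldsymbol n$ is the standard surface (area) measure on $S^2$ (in spherical coordinates $\boldsymbol n=(\sin\theta\cos\phi,\sin\theta\sin\phi,\cos\theta)$, $\mathrm{d}^2\boldsymbol n=\sin\theta\,\mathrm{d}\theta\,\mathrm{d}\phi$). $|\cdot|$ is the Euclidean norm. *)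

theory Defs
  imports "HOL-Analysis.Analysis"
begin

text \<open>Diagonal 3x3 matrix diag(t1,t2,t3) from the vector of diagonal entries.\<close>
definition diag3 :: "real^3 \<Rightarrow> real^3^3" where
  "diag3 t = (\<chi> i j. if i = j then t $ i else 0)"

text \<open>Spherical-coordinate parametrisation of the unit sphere S^2.\<close>
definition sph :: "real \<Rightarrow> real \<Rightarrow> real^3" where
  "sph \<theta> \<phi> = vector [sin \<theta> * cos \<phi>, sin \<theta> * sin \<phi>, cos \<theta>]"

text \<open>Integrand of the surface integral over A \<subseteq> S^2 of f with respect to the
  standard area measure d^2 n = sin(theta) dtheta dphi, as a function on the
  parameter rectangle [0,pi] x [0,2pi].\<close>
definition sph_integrand :: "(real^3 \<Rightarrow> real^3) \<Rightarrow> (real^3) set \<Rightarrow> real \<times> real \<Rightarrow> real^3" where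
  "sph_integrand f A = (\<lambda>(\<theta>, \<phi>). if sph \<theta> \<phi> \<in> A then sin \<theta> *\<^sub>R f (sph \<theta> \<phi>) else 0)"

end

(*
  Integrating r^3 from 0 to (n' Q n)^(-1/2) gives 1/(4 (n' Q n)^2), so in spherical coordinates x = r n
  the first moment  integral x dx  of the half-ellipsoid E = {x. x.v >= 0, x' Q x <= 1}, Q = T^-2,
  equals one quarter of the hemisphere integral in question.  On the other hand x = T R y, with R
  orthogonal and R e3 = T v / |T v|, maps the upper unit half-ball onto E, and the half-ball has first
  moment (pi/4) e3 (again by spherical coordinates, where it is elementary).  Hence
  integral x dx over E = |det T| T R (pi/4) e3 = (pi/4) |det T| T^2 v / |T v|.
*)

theory Submission
  imports Defs
begin

section \<open>Spherical coordinates\<close>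

lemma inner_real3: "x \<bullet> y = x$1 * y$1 + x$2 * y$2 + x$3 * y$3" for x y :: "real^3"
  by (simp add: inner_vec_def sum_3)

lemma Basis_real3: "(Basis :: (real^3) set) = {axis 1 1, axis 2 1, axis 3 1}"
  by (auto simp: Basis_vec_def UNIV_3)

lemma vector3_eq_axis: "(vector [x, y, z] :: real^3) = x *\<^sub>R axis 1 1 + y *\<^sub>R axis 2 1 + z *\<^sub>R axis 3 1"
  by (simp add: vec_eq_iff forall_3 axis_def)

lemma vec_nth_has_derivative [derivative_intros]:
  "((\<lambda>x::real^'n. x$i) has_derivative (\<lambda>h. h$i)) F"
  by (rule bounded_linear_imp_has_derivative) (rule bounded_linear_vec_nth)

lemma sph_inner_sph [simp]: "sph \<theta> \<phi> \<bullet> sph \<theta> \<phi> = 1"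
  unfolding inner_real3 sph_def vector_3
  using sin_cos_squared_add[of \<theta>] sin_cos_squared_add[of \<phi>] by algebra

lemma norm_sph [simp]: "norm (sph \<theta> \<phi>) = 1"
  by (simp add: norm_eq_1)

lemma sph_nonzero [simp]: "sph \<theta> \<phi> \<noteq> 0"
  by (metis norm_sph norm_zero zero_neq_one)

lemma sin_cos_inj_2pi:
  assumes "0 \<le> x" "x < 2*pi" "0 \<le> y" "y < 2*pi" "sin x = sin y" "cos x = cos y"
  shows "x = y"
proof -
  obtain n :: int where n: "x = y + 2 * pi * n"
    using assms sin_cos_eq_iff by metis
  then have "\<bar>2 * pi * real_of_int n\<bar> < 2 * pi"
    using assms by auto
  then have "\<bar>real_of_int n\<bar> < 1"
    by (simp add: abs_mult)
  then show ?thesis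
    using n by simp
qed

lemma sph_eq_sph_iff:
  assumes "0 < \<theta>" "\<theta> < pi" "0 \<le> \<phi>" "\<phi> < 2*pi"
    and "0 < \<theta>'" "\<theta>' < pi" "0 \<le> \<phi>'" "\<phi>' < 2*pi"
  shows "sph \<theta> \<phi> = sph \<theta>' \<phi>' \<longleftrightarrow> \<theta> = \<theta>' \<and> \<phi> = \<phi>'"
proof
  assume eq: "sph \<theta> \<phi> = sph \<theta>' \<phi>'"
  have "cos \<theta> = cos \<theta>'"
    using arg_cong[OF eq, of "\<lambda>n. n$3"] by (simp add: sph_def)
  then have \<theta>: "\<theta> = \<theta>'"
    by (rule cos_inj_pi[rotated 4]) (use assms in auto)
  have "sin \<theta> \<noteq> 0"
    using assms by (simp add: sin_gt_zero less_imp_neq[symmetric])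
  moreover have "sin \<theta> * cos \<phi> = sin \<theta> * cos \<phi>'" "sin \<theta> * sin \<phi> = sin \<theta> * sin \<phi>'"
    using arg_cong[OF eq, of "\<lambda>n. n$1"] arg_cong[OF eq, of "\<lambda>n. n$2"] by (simp_all add: sph_def \<theta>)
  ultimately have "cos \<phi> = cos \<phi>'" "sin \<phi> = sin \<phi>'"
    by simp_all
  then show "\<theta> = \<theta>' \<and> \<phi> = \<phi>'"
    using sin_cos_inj_2pi[of \<phi> \<phi>'] assms \<theta> by simp
qed simp

lemma unit_vector_eq_sph:
  assumes "norm n = 1" "n$2 \<noteq> 0"
  obtains \<theta> \<phi> where "0 < \<theta>" "\<theta> < pi" "0 < \<phi>" "\<phi> < 2*pi" "n = sph \<theta> \<phi>"
proof -
  define \<rho> where "\<rho> = sqrt ((n$1)^2 + (n$2)^2)"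
  have \<rho>: "0 < \<rho>"
    using assms(2) by (simp add: \<rho>_def add_nonneg_pos)
  have sum_sq: "(n$1)^2 + (n$2)^2 + (n$3)^2 = 1"
    using assms(1) by (simp add: norm_eq_1 inner_real3 power2_eq_square)
  moreover have "0 < (n$2)^2"
    using assms(2) by simp
  ultimately have "(n$3)^2 < 1"
    using zero_le_power2[of "n$1"] by linarith
  then have "\<bar>n$3\<bar> < 1"
    by (simp add: abs_square_less_1)
  then have n3: "-1 < n$3" "n$3 < 1" by auto
  define \<theta> where "\<theta> = arccos (n$3)"
  have \<theta>: "0 < \<theta>" "\<theta> < pi" "cos \<theta> = n$3"
    using arccos_lt_bounded[OF n3] n3 by (auto simp: \<theta>_def)
  have "1 - (n$3)^2 = (n$1)^2 + (n$2)^2"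
    using sum_sq by simp
  then have sin_\<theta>: "sin \<theta> = \<rho>"
    using n3 by (simp add: \<theta>_def sin_arccos \<rho>_def)
  have "(n$1 / \<rho>)^2 + (n$2 / \<rho>)^2 = ((n$1)^2 + (n$2)^2) / \<rho>^2"
    by (simp add: power_divide add_divide_distrib)
  also have "\<dots> = 1"
    using assms(2) by (simp add: \<rho>_def)
  finally have "(n$1 / \<rho>)^2 + (n$2 / \<rho>)^2 = 1" .
  then obtain \<phi> where \<phi>: "0 \<le> \<phi>" "\<phi> < 2*pi" "n$1 / \<rho> = cos \<phi>" "n$2 / \<rho> = sin \<phi>"
    by (rule sincos_total_2pi)
  have "\<phi> \<noteq> 0"
    using \<phi> \<rho> assms(2) by auto
  then have "0 < \<phi>"
    using \<phi>(1) by linarith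
  have "n$1 = \<rho> * cos \<phi>" "n$2 = \<rho> * sin \<phi>"
    using \<phi>(3,4) \<rho> by (simp_all add: field_simps)
  then have "n = sph \<theta> \<phi>"
    using \<theta>(3) sin_\<theta> by (simp add: sph_def vec_eq_iff forall_3)
  then show ?thesis
    by (rule that[OF \<theta>(1,2) \<open>0 < \<phi>\<close> \<phi>(2)])
qed

(* A point p of the parameter domain is (theta, phi, r) = (p$1, p$2, p$3), matching the product order
   ((theta, phi), r) used for Fubini below. *)

definition spherical :: "real^3 \<Rightarrow> real^3" where
  "spherical p = p$3 *\<^sub>R sph (p$1) (p$2)"

definition spherical_deriv :: "real^3 \<Rightarrow> real^3 \<Rightarrow> real^3" where
  "spherical_deriv p h = vector
     [h$3 * sin (p$1) * cos (p$2) + p$3 * cos (p$1) * cos (p$2) * h$1 - p$3 * sin (p$1) * sin (p$2) * h$2,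
      h$3 * sin (p$1) * sin (p$2) + p$3 * cos (p$1) * sin (p$2) * h$1 + p$3 * sin (p$1) * cos (p$2) * h$2,
      h$3 * cos (p$1) - p$3 * sin (p$1) * h$1]"

lemma has_derivative_spherical: "(spherical has_derivative spherical_deriv p) (at p within S)"
  unfolding spherical_def spherical_deriv_def sph_def vector3_eq_axis
  by (rule derivative_eq_intros refl | simp)+ (simp add: algebra_simps)

lemma det_spherical_deriv: "det (matrix (spherical_deriv p)) = (p$3)^2 * sin (p$1)"
  unfolding det_3 matrix_def spherical_deriv_def
  by (simp add: axis_def) (use sin_cos_squared_add[of "p$1"] sin_cos_squared_add[of "p$2"] in algebra)

definition spherical_domain :: "(real^3) set" where
  "spherical_domain = {p. 0 < p$1 \<and> p$1 < pi \<and> 0 < p$2 \<and> p$2 < 2*pi \<and> 0 < p$3}"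

lemma open_spherical_domain: "open spherical_domain"
  unfolding spherical_domain_def
  by (intro open_Collect_conj open_Collect_less continuous_intros)

lemma inj_on_spherical: "inj_on spherical spherical_domain"
proof (rule inj_onI)
  fix p q assume p: "p \<in> spherical_domain" and q: "q \<in> spherical_domain"
    and eq: "spherical p = spherical q"
  have "p$3 = q$3"
    using arg_cong[OF eq, of norm] p q by (simp add: spherical_def spherical_domain_def)
  then have "sph (p$1) (p$2) = sph (q$1) (q$2)"
    using eq p by (simp add: spherical_def spherical_domain_def)
  then have "p$1 = q$1" "p$2 = q$2"
    using p q sph_eq_sph_iff by (auto simp: spherical_domain_def)
  with \<open>p$3 = q$3\<close> show "p = q"
    by (simp add: vec_eq_iff forall_3)
qed

lemma spherical_image_domain: "{x. x$2 \<noteq> 0} \<subseteq> spherical ` spherical_domain"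
proof
  fix x :: "real^3" assume "x \<in> {x. x$2 \<noteq> 0}"
  then have x: "x \<noteq> 0" "(x /\<^sub>R norm x) $ 2 \<noteq> 0"
    by auto
  then obtain \<theta> \<phi> where "0 < \<theta>" "\<theta> < pi" "0 < \<phi>" "\<phi> < 2*pi" "x /\<^sub>R norm x = sph \<theta> \<phi>"
    using unit_vector_eq_sph[of "x /\<^sub>R norm x"] by auto
  moreover have "x = norm x *\<^sub>R (x /\<^sub>R norm x)"
    using x by simp
  ultimately have "vector [\<theta>, \<phi>, norm x] \<in> spherical_domain" "x = spherical (vector [\<theta>, \<phi>, norm x])"
    using x by (auto simp: spherical_domain_def spherical_def)
  then show "x \<in> spherical ` spherical_domain"
    by blast
qed

lemma absolutely_integrable_spherical_domain:
  fixes F :: "real^3 \<Rightarrow> real^'n"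
  assumes "F absolutely_integrable_on UNIV"
  shows "(\<lambda>p. ((p$3)^2 * sin (p$1)) *\<^sub>R F (spherical p)) absolutely_integrable_on spherical_domain
    \<and> integral spherical_domain (\<lambda>p. ((p$3)^2 * sin (p$1)) *\<^sub>R F (spherical p)) = integral UNIV F"
proof -
  let ?S = "spherical ` spherical_domain"
  have "negligible {x :: real^3. x \<bullet> axis 2 1 = 0}"
    by (rule negligible_standard_hyperplane) (simp add: Basis_real3)
  then have N: "negligible {x \<in> UNIV - ?S. F x \<noteq> 0}"
    by (rule negligible_subset) (use spherical_image_domain in \<open>auto simp: inner_axis\<close>)
  have N0: "negligible {x \<in> ?S - UNIV. F x \<noteq> 0}"
    by simp
  have "F absolutely_integrable_on ?S" "integral ?S F = integral UNIV F"
    using assms absolutely_integrable_spike_set_eq[OF N0 N] integral_spike_set[OF N0 N] by auto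
  moreover have "spherical_domain \<in> sets lebesgue"
    using borel_open[OF open_spherical_domain] by simp
  ultimately have "(\<lambda>p. \<bar>det (matrix (spherical_deriv p))\<bar> *\<^sub>R F (spherical p)) absolutely_integrable_on spherical_domain
    \<and> integral spherical_domain (\<lambda>p. \<bar>det (matrix (spherical_deriv p))\<bar> *\<^sub>R F (spherical p)) = integral UNIV F"
    using has_absolute_integral_change_of_variables[OF _ has_derivative_spherical inj_on_spherical] by blast
  moreover have "\<bar>det (matrix (spherical_deriv p))\<bar> *\<^sub>R F (spherical p) = ((p$3)^2 * sin (p$1)) *\<^sub>R F (spherical p)"
    if "p \<in> spherical_domain" for p
  proof -
    have "0 < sin (p$1)"
      using that by (simp add: spherical_domain_def sin_gt_zero)
    then show ?thesis
      by (simp add: det_spherical_deriv)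
  qed
  ultimately show ?thesis
    using set_integrable_cong[OF refl refl] integral_cong by (metis (no_types, lifting))
qed

lemma vector3_measurable [measurable]:
  "(\<lambda>((x, y), z). vector [x, y, z] :: real^3) \<in> borel_measurable borel"
  by (intro borel_measurable_continuous_onI)
    (auto simp: vector3_eq_axis case_prod_beta intro!: continuous_intros)

lemma distr_vector3_lborel: "distr lborel borel (\<lambda>((x, y), z). vector [x, y, z]) = (lborel :: (real^3) measure)"
proof (rule lborel_eqI[symmetric])
  let ?v = "\<lambda>((x, y), z). vector [x, y, z] :: real^3"
  fix l u :: "real^3" assume lu: "\<And>b. b \<in> Basis \<Longrightarrow> l \<bullet> b \<le> u \<bullet> b"
  have le: "l$i \<le> u$i" for i
    using lu[of "axis i 1"] by (simp add: inner_axis)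
  have "?v -` box l u = ({l$1<..<u$1} \<times> {l$2<..<u$2}) \<times> {l$3<..<u$3}"
    by (auto simp: mem_box_cart forall_3)
  then have "emeasure (distr lborel borel ?v) (box l u)
      = emeasure (lborel \<Otimes>\<^sub>M lborel) (({l$1<..<u$1} \<times> {l$2<..<u$2}) \<times> {l$3<..<u$3})"
    by (simp add: emeasure_distr lborel_prod)
  also have "\<dots> = emeasure lborel ({l$1<..<u$1} \<times> {l$2<..<u$2}) * emeasure lborel {l$3<..<u$3}"
    by (rule lborel.emeasure_pair_measure_Times) (auto intro!: borel_open open_Times)
  also have "emeasure lborel ({l$1<..<u$1} \<times> {l$2<..<u$2}) = emeasure lborel {l$1<..<u$1} * emeasure lborel {l$2<..<u$2}"
    unfolding lborel_prod[symmetric] by (rule lborel.emeasure_pair_measure_Times) auto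
  also have "\<dots> * emeasure lborel {l$3<..<u$3} = ennreal ((u$1 - l$1) * (u$2 - l$2) * (u$3 - l$3))"
    using le by (simp add: ennreal_mult)
  also have "\<dots> = ennreal (\<Prod>b\<in>Basis. (u - l) \<bullet> b)"
    by (simp add: Basis_real3 inner_axis axis_eq_axis mult.assoc)
  finally show "emeasure (distr lborel borel ?v) (box l u) = ennreal (\<Prod>b\<in>Basis. (u - l) \<bullet> b)" .
qed simp

lemma spherical_measurable [measurable]: "spherical \<in> borel_measurable borel"
  by (intro borel_measurable_continuous_onI)
    (auto simp: spherical_def sph_def vector3_eq_axis intro!: continuous_intros)

lemma has_integral_partial_integral_vector3:
  fixes G :: "real^3 \<Rightarrow> real^'n"
  assumes G: "integrable lborel G"
  shows "((\<lambda>(x, y). \<integral>z. G (vector [x, y, z]) \<partial>lborel) has_integral integral\<^sup>L lborel G) UNIV"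
proof -
  have [measurable]: "G \<in> borel_measurable borel"
    using borel_measurable_integrable[OF G] by simp
  define H where "H = G \<circ> (\<lambda>((x, y), z). vector [x, y, z])"
  have H_int: "integrable (lborel \<Otimes>\<^sub>M lborel) H"
    using G unfolding lborel_prod H_def distr_vector3_lborel[symmetric]
    by (subst (asm) integrable_distr_eq) (auto simp: o_def)
  have H_integral: "integral\<^sup>L (lborel \<Otimes>\<^sub>M lborel) H = integral\<^sup>L lborel G"
    unfolding lborel_prod H_def distr_vector3_lborel[symmetric]
    by (subst integral_distr) (auto simp: o_def)
  have "integrable lborel (\<lambda>y. \<integral>z. H (y, z) \<partial>lborel)"
    using lborel_pair.integrable_fst'[OF H_int] by (simp add: lborel_prod)
  moreover have "(\<integral>y. (\<integral>z. H (y, z) \<partial>lborel) \<partial>lborel) = integral\<^sup>L lborel G"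
    using lborel_pair.integral_fst'[OF H_int] H_integral by (simp add: lborel_prod)
  ultimately have "((\<lambda>y. \<integral>z. H (y, z) \<partial>lborel) has_integral integral\<^sup>L lborel G) UNIV"
    using has_integral_integral_lborel by metis
  then show ?thesis
    by (simp add: H_def case_prod_beta')
qed

theorem has_integral_spherical_coordinates:
  fixes F :: "real^3 \<Rightarrow> real^'n"
  assumes F: "F absolutely_integrable_on UNIV" and [measurable]: "F \<in> borel_measurable borel"
  shows "((\<lambda>(\<theta>, \<phi>). LINT r:{0<..}|lborel. (r^2 * sin \<theta>) *\<^sub>R F (r *\<^sub>R sph \<theta> \<phi>))
           has_integral integral UNIV F) (cbox (0, 0) (pi, 2*pi))"
    (is "(?g has_integral _) _")
proof -
  define G where "G p = (if p \<in> spherical_domain then ((p$3)^2 * sin (p$1)) *\<^sub>R F (spherical p) else 0)"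
    for p
  have [measurable]: "spherical_domain \<in> sets borel"
    by (rule borel_open[OF open_spherical_domain])
  have [measurable]: "G \<in> borel_measurable borel"
    unfolding G_def by measurable
  have "G absolutely_integrable_on UNIV" "integral UNIV G = integral UNIV F"
    using absolutely_integrable_spherical_domain[OF F] unfolding G_def[abs_def]
    by (auto simp: absolutely_integrable_restrict_UNIV integral_restrict_UNIV)
  then have "integrable lborel G" "integral\<^sup>L lborel G = integral UNIV F"
    by (auto simp: set_integrable_def integrable_completion integral_lborel)
  then have "((\<lambda>(\<theta>, \<phi>). \<integral>r. G (vector [\<theta>, \<phi>, r]) \<partial>lborel) has_integral integral UNIV F) UNIV"
    using has_integral_partial_integral_vector3 by metis
  moreover have "(\<lambda>(\<theta>, \<phi>). \<integral>r. G (vector [\<theta>, \<phi>, r]) \<partial>lborel)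
      = (\<lambda>y. indicator (box (0, 0) (pi, 2*pi)) y *\<^sub>R ?g y)"
  proof
    fix y :: "real \<times> real"
    obtain \<theta> \<phi> where y: "y = (\<theta>, \<phi>)"
      by fastforce
    have "vector [\<theta>, \<phi>, r] \<in> spherical_domain \<longleftrightarrow> (\<theta>, \<phi>) \<in> box (0, 0) (pi, 2*pi) \<and> r \<in> {0<..}" for r
      by (auto simp: spherical_domain_def box_def Basis_prod_def)
    then have G_eq: "G (vector [\<theta>, \<phi>, r]) = indicator (box (0, 0) (pi, 2*pi)) (\<theta>, \<phi>) *\<^sub>R
        (indicator {0<..} r *\<^sub>R (r^2 * sin \<theta>) *\<^sub>R F (r *\<^sub>R sph \<theta> \<phi>))" for r
      by (auto simp: G_def spherical_def indicator_def)
    show "(\<lambda>(\<theta>, \<phi>). \<integral>r. G (vector [\<theta>, \<phi>, r]) \<partial>lborel) y = indicator (box (0, 0) (pi, 2*pi)) y *\<^sub>R ?g y"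
      unfolding y prod.case G_eq integral_scaleR_right by (simp only: set_lebesgue_integral_def)
  qed
  ultimately have "(?g has_integral integral UNIV F) (box (0, 0) (pi, 2*pi))"
    by (simp add: indicator_scaleR_eq_if has_integral_restrict_UNIV)
  then show ?thesis
    by (simp add: has_integral_open_interval)
qed

section \<open>Half-ellipsoids\<close>

definition half_ellipsoid :: "real^'n^'n \<Rightarrow> real^'n \<Rightarrow> (real^'n) set" where
  "half_ellipsoid Q w = {x. 0 \<le> x \<bullet> w \<and> x \<bullet> (Q *v x) \<le> 1}"

lemma closed_half_ellipsoid: "closed (half_ellipsoid Q w)"
proof -
  have "continuous_on UNIV (\<lambda>x. x \<bullet> (Q *v x))"
    using linear_continuous_on[OF matrix_vector_mul_bounded_linear] by (intro continuous_intros)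
  then show ?thesis
    unfolding half_ellipsoid_def by (intro closed_Collect_conj closed_Collect_le continuous_intros)
qed

lemma scaleR_mem_half_ellipsoid_iff:
  assumes "0 < r" "0 < n \<bullet> (Q *v n)"
  shows "r *\<^sub>R n \<in> half_ellipsoid Q w \<longleftrightarrow> 0 \<le> n \<bullet> w \<and> r \<le> 1 / sqrt (n \<bullet> (Q *v n))"
proof -
  let ?c = "sqrt (n \<bullet> (Q *v n))"
  have "r *\<^sub>R n \<bullet> (Q *v (r *\<^sub>R n)) = (r * ?c)^2"
    using assms(2) by (simp add: matrix_vector_mult_scaleR power_mult_distrib power2_eq_square)
  moreover have "(r * ?c)^2 \<le> 1^2 \<longleftrightarrow> r * ?c \<le> 1"
    using assms by (intro power_mono_iff) auto
  moreover have "r * ?c \<le> 1 \<longleftrightarrow> r \<le> 1 / ?c"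
    using assms by (simp add: field_simps)
  ultimately show ?thesis
    using assms(1) by (simp add: half_ellipsoid_def zero_le_mult_iff)
qed

lemma ray_integral_half_ellipsoid:
  fixes n :: "real^'n"
  assumes q: "0 < n \<bullet> (Q *v n)"
  shows "(LINT r:{0<..}|lborel. (r^2 * s) *\<^sub>R (if r *\<^sub>R n \<in> half_ellipsoid Q w then r *\<^sub>R n else 0))
    = (if 0 \<le> n \<bullet> w then (s / (4 * (n \<bullet> (Q *v n))^2)) *\<^sub>R n else 0)"
proof -
  define b where "b = 1 / sqrt (n \<bullet> (Q *v n))"
  have "b^2 = 1 / (n \<bullet> (Q *v n))"
    using q by (simp add: b_def power_divide)
  then have b: "0 < b" "b^4 = 1 / (n \<bullet> (Q *v n))^2"
    using q by (simp_all add: b_def power4_eq_xxxx power2_eq_square flip: mult.assoc)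
  have "indicator {0<..} r *\<^sub>R (r^2 * s) *\<^sub>R (if r *\<^sub>R n \<in> half_ellipsoid Q w then r *\<^sub>R n else 0)
      = (if 0 \<le> n \<bullet> w then (r^3 * indicator {0..b} r) *\<^sub>R (s *\<^sub>R n) else 0)" for r
    using scaleR_mem_half_ellipsoid_iff[OF _ q, of r w] b
    by (cases "0 < r") (auto simp: indicator_def b_def power3_eq_cube power2_eq_square)
  moreover have "(\<integral>r. r^3 * indicator {0..b} r \<partial>lborel) = b^4 / 4"
    using b by (simp add: integral_power)
  moreover have "integrable lborel (\<lambda>r. r^3 * indicator {0..b} r :: real)"
    by (intro borel_integrable_atLeastAtMost) auto
  ultimately show ?thesis
    using b by (simp add: set_lebesgue_integral_def field_simps)
qed

lemma sph_integrand_scaleR: "sph_integrand (\<lambda>n. c *\<^sub>R f n) A = (\<lambda>x. c *\<^sub>R sph_integrand f A x)"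
  by (auto simp: sph_integrand_def fun_eq_iff)

lemma has_integral_sph_integrand_half_ellipsoid:
  fixes Q :: "real^3^3"
  assumes Q: "\<And>x. x \<noteq> 0 \<Longrightarrow> 0 < x \<bullet> (Q *v x)"
    and E: "(\<lambda>x. x) absolutely_integrable_on half_ellipsoid Q w"
  shows "(sph_integrand (\<lambda>n. (1 / (4 * (n \<bullet> (Q *v n))^2)) *\<^sub>R n) {n. 0 \<le> n \<bullet> w}
    has_integral integral (half_ellipsoid Q w) (\<lambda>x. x)) (cbox (0, 0) (pi, 2*pi))"
proof -
  let ?F = "\<lambda>x. if x \<in> half_ellipsoid Q w then x else 0"
  have [measurable]: "half_ellipsoid Q w \<in> sets borel"
    by (rule borel_closed[OF closed_half_ellipsoid])
  have "?F absolutely_integrable_on UNIV"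
    using E by (simp add: absolutely_integrable_restrict_UNIV)
  moreover have "?F \<in> borel_measurable borel"
    by measurable
  ultimately have "((\<lambda>(\<theta>, \<phi>). LINT r:{0<..}|lborel. (r^2 * sin \<theta>) *\<^sub>R ?F (r *\<^sub>R sph \<theta> \<phi>))
      has_integral integral UNIV ?F) (cbox (0, 0) (pi, 2*pi))"
    by (rule has_integral_spherical_coordinates)
  moreover have "integral UNIV ?F = integral (half_ellipsoid Q w) (\<lambda>x. x)"
    by (simp add: integral_restrict_UNIV)
  moreover have "(LINT r:{0<..}|lborel. (r^2 * sin \<theta>) *\<^sub>R ?F (r *\<^sub>R sph \<theta> \<phi>))
      = sph_integrand (\<lambda>n. (1 / (4 * (n \<bullet> (Q *v n))^2)) *\<^sub>R n) {n. 0 \<le> n \<bullet> w} (\<theta>, \<phi>)" for \<theta> \<phi>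
  proof -
    have "0 < sph \<theta> \<phi> \<bullet> (Q *v sph \<theta> \<phi>)"
      using Q by simp
    then show ?thesis
      by (simp add: ray_integral_half_ellipsoid sph_integrand_def)
  qed
  ultimately show ?thesis
    by (simp add: case_prod_beta')
qed

lemma half_ellipsoid_linear_image:
  assumes "surj L" "0 < c"
    and "\<And>y. L y \<bullet> w = c * (y \<bullet> u)" "\<And>y. L y \<bullet> (Q *v L y) = y \<bullet> (P *v y)"
  shows "L ` half_ellipsoid P u = half_ellipsoid Q w"
proof -
  have mem: "L y \<in> half_ellipsoid Q w \<longleftrightarrow> y \<in> half_ellipsoid P u" for y
    using assms by (simp add: half_ellipsoid_def zero_le_mult_iff)
  show ?thesis
  proof (intro equalityI subsetI)
    fix x assume "x \<in> half_ellipsoid Q w"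
    moreover obtain y where "x = L y"
      using \<open>surj L\<close> by (metis surjD)
    ultimately show "x \<in> L ` half_ellipsoid P u"
      using mem by blast
  qed (use mem in auto)
qed

lemma first_moment_linear_image:
  fixes L :: "real^'n::{finite,wellorder} \<Rightarrow> real^'n::_"
  assumes "linear L" and S: "(\<lambda>x. x) absolutely_integrable_on S"
  shows "(\<lambda>x. x) absolutely_integrable_on L ` S
    \<and> integral (L ` S) (\<lambda>x. x) = \<bar>det (matrix L)\<bar> *\<^sub>R L (integral S (\<lambda>x. x))"
proof -
  let ?h = "\<lambda>x. \<bar>det (matrix L)\<bar> *\<^sub>R L x"
  have h: "bounded_linear ?h"
    using assms(1) by (intro bounded_linear_compose[OF bounded_linear_scaleR_right]) (rule linear_conv_bounded_linear[THEN iffD1])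
  have "(?h \<circ> (\<lambda>x. x)) absolutely_integrable_on S"
    by (rule absolutely_integrable_linear[OF S h])
  moreover have "integral S (?h \<circ> (\<lambda>x. x)) = ?h (integral S (\<lambda>x. x))"
    using S set_lebesgue_integral_eq_integral(1) h by (intro integral_linear) auto
  ultimately show ?thesis
    using has_absolute_integral_change_of_variables_linear[OF assms(1),
        where f = "\<lambda>x. x" and S = S and b = "?h (integral S (\<lambda>x. x))"]
    unfolding o_def by blast
qed

section \<open>The upper half-ball\<close>

lemma absolutely_integrable_half_ball:
  fixes u :: "real^'n"
  shows "(\<lambda>x. x) absolutely_integrable_on half_ellipsoid (mat 1) u"
proof -
  have "(\<lambda>x. x) absolutely_integrable_on cbox (-1) (1 :: real^'n)"
    by (rule absolutely_integrable_continuous) (rule continuous_on_id)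
  moreover have "half_ellipsoid (mat 1) u \<in> sets lebesgue"
    using borel_closed[OF closed_half_ellipsoid[of "mat 1" u]] by simp
  moreover have "half_ellipsoid (mat 1) u \<subseteq> cbox (-1) 1"
  proof
    fix x :: "real^'n" assume "x \<in> half_ellipsoid (mat 1) u"
    then have "norm x \<le> 1"
      by (simp add: half_ellipsoid_def norm_eq_sqrt_inner)
    then have "\<bar>x$i\<bar> \<le> 1" for i
      using component_le_norm_cart[of x i] by linarith
    then show "x \<in> cbox (-1) 1"
      unfolding mem_box_cart by (simp add: abs_le_iff)
  qed
  ultimately show ?thesis
    by (rule set_integrable_subset)
qed

lemma has_integral_sph_azimuth: "((\<lambda>\<phi>. sph \<theta> \<phi>) has_integral (2 * pi * cos \<theta>) *\<^sub>R axis 3 1) {0..2*pi}"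
proof -
  define F where "F \<phi> = (vector [sin \<theta> * sin \<phi>, - sin \<theta> * cos \<phi>, \<phi> * cos \<theta>] :: real^3)" for \<phi>
  have "((\<lambda>\<phi>. sph \<theta> \<phi>) has_integral (F (2*pi) - F 0)) {0..2*pi}"
    by (rule fundamental_theorem_of_calculus)
      (auto simp: F_def sph_def vector3_eq_axis mult.commute intro!: derivative_eq_intros)
  also have "F (2*pi) - F 0 = (2 * pi * cos \<theta>) *\<^sub>R axis 3 1"
    by (simp add: F_def vector3_eq_axis)
  finally show ?thesis .
qed

lemma has_integral_sin_mult_cos: "((\<lambda>\<theta>. sin \<theta> * cos \<theta>) has_integral 1/2) {0..pi/2}"
proof -
  have "((\<lambda>\<theta>. sin \<theta> * cos \<theta>) has_integral ((sin (pi/2))^2 / 2 - (sin 0)^2 / 2)) {0..pi/2}"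
    by (rule fundamental_theorem_of_calculus)
      (auto simp: has_real_derivative_iff_has_vector_derivative[symmetric] intro!: derivative_eq_intros)
  then show ?thesis
    by simp
qed

lemma cos_nonneg_iff_le_pi_half:
  assumes "0 \<le> \<theta>" "\<theta> \<le> pi"
  shows "0 \<le> cos \<theta> \<longleftrightarrow> \<theta> \<le> pi/2"
proof
  assume "0 \<le> cos \<theta>"
  show "\<theta> \<le> pi/2"
  proof (rule ccontr)
    assume "\<not> \<theta> \<le> pi/2"
    then have "0 < cos (pi - \<theta>)"
      using assms by (intro cos_gt_zero_pi) auto
    with \<open>0 \<le> cos \<theta>\<close> show False
      by simp
  qed
qed (use assms in \<open>auto intro: cos_ge_zero\<close>)

lemma has_integral_upper_hemisphere_moment:
  "((\<lambda>(\<theta>, \<phi>). (sin \<theta> / 4) *\<^sub>R sph \<theta> \<phi>) has_integral (pi/4) *\<^sub>R axis 3 1) (cbox (0, 0) (pi/2, 2*pi))"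
proof -
  let ?k = "\<lambda>(\<theta>, \<phi>). (sin \<theta> / 4) *\<^sub>R sph \<theta> \<phi>"
  have cont: "continuous_on (cbox (0, 0) (pi/2, 2*pi)) ?k"
    by (auto simp: case_prod_beta sph_def vector3_eq_axis intro!: continuous_intros)
  have inner: "((\<lambda>\<phi>. ?k (\<theta>, \<phi>)) has_integral (sin \<theta> * cos \<theta>) *\<^sub>R ((pi/2) *\<^sub>R axis 3 1)) {0..2*pi}" for \<theta>
    using has_integral_cmul[OF has_integral_sph_azimuth, of "sin \<theta> / 4" \<theta>] by (simp add: ac_simps)
  have "integral (cbox (0, 0) (pi/2, 2*pi)) ?k
      = integral {0..pi/2} (\<lambda>\<theta>. (sin \<theta> * cos \<theta>) *\<^sub>R ((pi/2) *\<^sub>R axis 3 1))"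
    unfolding integral_prod_continuous[OF cont] by (simp only: cbox_interval integral_unique[OF inner])
  also have "\<dots> = (pi/4) *\<^sub>R axis 3 1"
    using has_integral_scaleR_left[OF has_integral_sin_mult_cos, of "(pi/2) *\<^sub>R (axis 3 1 :: real^3)"]
    by (simp add: integral_unique)
  finally show ?thesis
    using integrable_continuous[OF cont] by (simp add: has_integral_integral)
qed

lemma has_integral_upper_half_ball:
  "((\<lambda>x. x) has_integral (pi/4) *\<^sub>R axis 3 1) (half_ellipsoid (mat 1) (axis 3 1 :: real^3))"
proof -
  let ?g = "sph_integrand (\<lambda>n. (1 / (4 * (n \<bullet> (mat 1 *v n))^2)) *\<^sub>R n) {n. 0 \<le> n \<bullet> axis 3 1}"
  have "(?g has_integral integral (half_ellipsoid (mat 1) (axis 3 1)) (\<lambda>x. x)) (cbox (0, 0) (pi, 2*pi))"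
    by (rule has_integral_sph_integrand_half_ellipsoid) (simp_all add: absolutely_integrable_half_ball)
  moreover have "(?g has_integral (pi/4) *\<^sub>R axis 3 1) (cbox (0, 0) (pi, 2*pi))"
  proof (rule has_integral_eq[OF _ has_integral_restrict_closed_subinterval[OF has_integral_upper_hemisphere_moment]])
    fix y :: "real \<times> real" assume "y \<in> cbox (0, 0) (pi, 2*pi)"
    then obtain \<theta> \<phi> where y: "y = (\<theta>, \<phi>)" "0 \<le> \<theta>" "\<theta> \<le> pi" "0 \<le> \<phi>" "\<phi> \<le> 2*pi"
      by (cases y) (auto simp: cbox_Pair_eq)
    have "0 \<le> sph \<theta> \<phi> \<bullet> axis 3 1 \<longleftrightarrow> \<theta> \<le> pi/2"
      using cos_nonneg_iff_le_pi_half[OF y(2,3)] by (simp add: inner_axis sph_def)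
    moreover have "y \<in> cbox (0, 0) (pi/2, 2*pi) \<longleftrightarrow> \<theta> \<le> pi/2"
      using y by (auto simp: cbox_Pair_eq)
    ultimately show "(if y \<in> cbox (0, 0) (pi/2, 2*pi) then (case y of (\<theta>, \<phi>) \<Rightarrow> (sin \<theta> / 4) *\<^sub>R sph \<theta> \<phi>) else 0) = ?g y"
      by (simp add: sph_integrand_def y(1))
  qed (auto simp: cbox_Pair_eq)
  ultimately have "integral (half_ellipsoid (mat 1) (axis 3 1 :: real^3)) (\<lambda>x. x) = (pi/4) *\<^sub>R axis 3 1"
    by (rule has_integral_unique)
  moreover have "(\<lambda>x. x) integrable_on half_ellipsoid (mat 1) (axis 3 1 :: real^3)"
    using absolutely_integrable_half_ball by (rule set_lebesgue_integral_eq_integral(1))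
  ultimately show ?thesis
    using has_integral_integral by metis
qed

lemma surj_of_quadratic_identity:
  fixes T :: "real^'n \<Rightarrow> real^'n"
  assumes T: "linear T" and TQ: "\<And>z. T z \<bullet> (Q *v T z) = z \<bullet> z"
  shows "surj T"
proof -
  have "inj T"
    unfolding linear_injective_0[OF T]
  proof (intro allI impI)
    fix z assume "T z = 0"
    then have "z \<bullet> z = 0"
      using TQ[of z] by simp
    then show "z = 0"
      by simp
  qed
  then show ?thesis
    using T by (simp add: linear_injective_imp_surjective)
qed

lemma quadratic_form_pos_of_quadratic_identity:
  fixes T :: "real^'n \<Rightarrow> real^'n"
  assumes T: "linear T" and TQ: "\<And>z. T z \<bullet> (Q *v T z) = z \<bullet> z" and "x \<noteq> 0"
  shows "0 < x \<bullet> (Q *v x)"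
proof -
  obtain z where z: "x = T z"
    using surj_of_quadratic_identity[OF T TQ] by (metis surjD)
  then have "z \<noteq> 0"
    using \<open>x \<noteq> 0\<close> linear_0[OF T] by auto
  then show ?thesis
    using TQ[of z] by (simp add: z)
qed

lemma half_ellipsoid_eq_image_half_ball:
  fixes T :: "real^'n \<Rightarrow> real^'n"
  assumes T: "linear T" and TQ: "\<And>z. T z \<bullet> (Q *v T z) = z \<bullet> z" and "v \<noteq> 0"
  obtains L where "linear L" "L ` half_ellipsoid (mat 1) (axis k 1) = half_ellipsoid Q v"
    "\<bar>det (matrix L)\<bar> = \<bar>det (matrix T)\<bar>" "L (axis k 1) = T (adjoint T v) /\<^sub>R norm (adjoint T v)"
proof -
  define a where "a = adjoint T v"
  have Ta: "T z \<bullet> v = z \<bullet> a" for z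
    by (simp add: a_def adjoint_works[OF T])
  have "surj T"
    by (rule surj_of_quadratic_identity[OF T TQ])
  have "a \<noteq> 0"
  proof
    assume "a = 0"
    obtain z where "v = T z"
      using \<open>surj T\<close> by (metis surjD)
    then have "v \<bullet> v = 0"
      using Ta[of z] \<open>a = 0\<close> by simp
    with \<open>v \<noteq> 0\<close> show False
      by simp
  qed
  then obtain R :: "real^'n \<Rightarrow> real^'n" where R: "orthogonal_transformation R" "R (axis k 1) = a /\<^sub>R norm a"
    using orthogonal_transformation_exists_1[of "axis k 1" "a /\<^sub>R norm a"] by auto
  have R_inner: "R x \<bullet> R y = x \<bullet> y" for x y
    using R(1) by (simp add: orthogonal_transformation_def)
  show ?thesis
  proof (rule that[of "T \<circ> R"])
    show "linear (T \<circ> R)"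
      using T R(1) by (simp add: orthogonal_transformation_linear linear_compose)
    show "(T \<circ> R) ` half_ellipsoid (mat 1) (axis k 1) = half_ellipsoid Q v"
    proof (rule half_ellipsoid_linear_image)
      show "surj (T \<circ> R)"
        by (rule comp_surj[OF orthogonal_transformation_surj[OF R(1)] \<open>surj T\<close>])
      show "(T \<circ> R) y \<bullet> v = norm a * (y \<bullet> axis k 1)" for y
      proof -
        have "(T \<circ> R) y \<bullet> v = R y \<bullet> (norm a *\<^sub>R (a /\<^sub>R norm a))"
          using \<open>a \<noteq> 0\<close> by (simp add: Ta)
        also have "\<dots> = norm a * (y \<bullet> axis k 1)"
          by (simp add: R(2)[symmetric] R_inner)
        finally show ?thesis .
      qed
      show "(T \<circ> R) y \<bullet> (Q *v (T \<circ> R) y) = y \<bullet> (mat 1 *v y)" for y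
        by (simp add: TQ R_inner)
    qed (use \<open>a \<noteq> 0\<close> in simp)
    show "\<bar>det (matrix (T \<circ> R))\<bar> = \<bar>det (matrix T)\<bar>"
      unfolding matrix_compose[OF orthogonal_transformation_linear[OF R(1)] T]
      using R(1) by (simp add: det_mul abs_mult)
    show "(T \<circ> R) (axis k 1) = T (adjoint T v) /\<^sub>R norm (adjoint T v)"
      using linear_cmul[OF T] by (simp add: R(2) a_def)
  qed
qed

(* The hypothesis on T and Q says Q = (T o adjoint T)^-1. *)

theorem has_integral_hemisphere_quadratic_form:
  fixes T :: "real^3 \<Rightarrow> real^3" and Q :: "real^3^3"
  assumes T: "linear T" and TQ: "\<And>z. T z \<bullet> (Q *v T z) = z \<bullet> z" and "v \<noteq> 0"
  shows "(sph_integrand (\<lambda>n. (1 / (n \<bullet> (Q *v n))^2) *\<^sub>R n) {n. 0 \<le> n \<bullet> v}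
    has_integral (pi * \<bar>det (matrix T)\<bar> / norm (adjoint T v)) *\<^sub>R T (adjoint T v)) (cbox (0, 0) (pi, 2*pi))"
proof -
  obtain L where L: "linear L" "L ` half_ellipsoid (mat 1) (axis 3 1) = half_ellipsoid Q v"
    "\<bar>det (matrix L)\<bar> = \<bar>det (matrix T)\<bar>" "L (axis 3 1) = T (adjoint T v) /\<^sub>R norm (adjoint T v)"
    using half_ellipsoid_eq_image_half_ball[OF T TQ \<open>v \<noteq> 0\<close>] by blast
  have E: "(\<lambda>x. x) absolutely_integrable_on half_ellipsoid Q v
      \<and> integral (half_ellipsoid Q v) (\<lambda>x. x) = \<bar>det (matrix L)\<bar> *\<^sub>R L ((pi/4) *\<^sub>R axis 3 1)"
    using first_moment_linear_image[OF L(1) absolutely_integrable_half_ball, of "axis 3 1"]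
    unfolding L(2) integral_unique[OF has_integral_upper_half_ball] .
  then have "4 *\<^sub>R integral (half_ellipsoid Q v) (\<lambda>x. x)
      = (pi * \<bar>det (matrix T)\<bar> / norm (adjoint T v)) *\<^sub>R T (adjoint T v)"
    using linear_cmul[OF L(1)] by (simp add: L(3,4) field_simps)
  moreover have "(sph_integrand (\<lambda>n. 4 *\<^sub>R ((1 / (4 * (n \<bullet> (Q *v n))^2)) *\<^sub>R n)) {n. 0 \<le> n \<bullet> v}
      has_integral 4 *\<^sub>R integral (half_ellipsoid Q v) (\<lambda>x. x)) (cbox (0, 0) (pi, 2*pi))"
    unfolding sph_integrand_scaleR
    using quadratic_form_pos_of_quadratic_identity[OF T TQ] E[THEN conjunct1]
    by (intro has_integral_cmul has_integral_sph_integrand_half_ellipsoid)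
  moreover have "(\<lambda>n. 4 *\<^sub>R ((1 / (4 * (n \<bullet> (Q *v n))^2)) *\<^sub>R n)) = (\<lambda>n. (1 / (n \<bullet> (Q *v n))^2) *\<^sub>R n)"
    by (simp add: fun_eq_iff)
  ultimately show ?thesis
    by simp
qed

section \<open>Diagonal matrices\<close>

lemma diag3_mult: "diag3 a ** diag3 b = diag3 (\<chi> i. a$i * b$i)"
  unfolding diag3_def matrix_matrix_mult_def vec_eq_iff forall_3
  by (simp add: sum_3)

lemma diag3_mulv: "diag3 a *v x = (\<chi> i. a$i * x$i)"
  unfolding diag3_def matrix_vector_mult_def vec_eq_iff forall_3
  by (simp add: sum_3)

lemma diag3_one: "diag3 (\<chi> i. 1) = mat 1"
  by (simp add: diag3_def mat_def vec_eq_iff)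

lemma transpose_diag3 [simp]: "transpose (diag3 a) = diag3 a"
  by (simp add: diag3_def transpose_def vec_eq_iff)

lemma matrix_inv_unique:
  fixes A :: "'a::semiring_1^'n^'n"
  assumes "A ** B = mat 1" "B ** A = mat 1"
  shows "matrix_inv A = B"
proof -
  have "A ** matrix_inv A = mat 1 \<and> matrix_inv A ** A = mat 1"
    unfolding matrix_inv_def by (rule someI[of _ B]) (use assms in blast)
  then have "matrix_inv A = matrix_inv A ** (A ** B)"
    using assms by simp
  also have "\<dots> = B"
    using \<open>A ** matrix_inv A = mat 1 \<and> matrix_inv A ** A = mat 1\<close> by (simp add: matrix_mul_assoc)
  finally show ?thesis .
qed

lemma matrix_inv_diag3:
  assumes "\<And>i. a$i \<noteq> 0"
  shows "matrix_inv (diag3 a) = diag3 (\<chi> i. 1 / a$i)"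
  by (rule matrix_inv_unique)
    (use assms in \<open>simp_all add: diag3_mult diag3_one\<close>)

theorem theorem1:
  fixes t v :: "real^3"
  assumes "t $ 1 * t $ 2 * t $ 3 \<noteq> 0"
      and "v \<noteq> 0"
  shows "(sph_integrand
            (\<lambda>n. (1 / (n \<bullet> (matrix_inv (diag3 t ** diag3 t) *v n)) ^ 2) *\<^sub>R n)
            {n. n \<bullet> v \<ge> 0}
          has_integral
            ((pi * \<bar>det (diag3 t)\<bar> / norm (diag3 t *v v)) *\<^sub>R ((diag3 t ** diag3 t) *v v)))
         (cbox (0, 0) (pi, 2 * pi))"
proof -
  let ?D = "diag3 t" and ?Q = "matrix_inv (diag3 t ** diag3 t)"
  have t: "t$i \<noteq> 0" for i
    using assms(1) exhaust_3[of i] by auto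
  have "(?D *v z) \<bullet> (?Q *v (?D *v z)) = z \<bullet> z" for z
    using t by (simp add: diag3_mult matrix_inv_diag3 diag3_mulv inner_real3 field_simps)
  then have "(sph_integrand (\<lambda>n. (1 / (n \<bullet> (?Q *v n))^2) *\<^sub>R n) {n. 0 \<le> n \<bullet> v}
    has_integral (pi * \<bar>det (matrix ((*v) ?D))\<bar> / norm (adjoint ((*v) ?D) v)) *\<^sub>R (?D *v adjoint ((*v) ?D) v))
    (cbox (0, 0) (pi, 2*pi))"
    using has_integral_hemisphere_quadratic_form[OF matrix_vector_mul_linear _ assms(2)] by blast
  then show ?thesis
    by (simp add: adjoint_matrix matrix_vector_mul_assoc)
qed

end
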